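(* (The Genial Entropy Inequality) For any corner density $f:I\rightarrow[0,\infty)$, $$-1-\int_I f(x)\ln(xf(x))\,dx\geq 0.$$
   Context: A corner density is a function $f:I\rightarrow[0,\infty)$ where $I\cup\{0\}$ is a connected interval contained in $[0,\infty)$, $f$ is monotone decreasing (not necessarily strictly), and $\int_I f\,dx=1$. The convention $0\ln(0)=0$ is used. The quantity $-1-\int_I f\ln(xf)\,dx$ is called the genial entropy of $f$ and is considered when the integral exists; the integral is understood as an extended real number, so that the left-hand side may be $+\infty$. *)

theory Defs
  imports "HOL-Analysis.Analysis"
begin

text \<open>
  A function \<open>I \<rightarrow> [0,\<infinity>)\<close> is modelled by a total function, only its values on \<open>I\<close> being used.
  The last conjunct includes integrability of \<open>f\<close> on \<open>I\<close>, since the Bochner integral of a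
  non-integrable function is \<open>0\<close>.
\<close>

definition corner_density :: "real set \<Rightarrow> (real \<Rightarrow> real) \<Rightarrow> bool" where
  "corner_density I f \<longleftrightarrow>
     is_interval (I \<union> {0}) \<and> I \<subseteq> {0..} \<and>
     (\<forall>x\<in>I. 0 \<le> f x) \<and> antimono_on I f \<and>
     (LINT x:I|lborel. f x) = 1"

text \<open>
  The Lebesgue integral over \<open>A\<close> as an extended real number: the integral of the positive part minus
  that of the negative part (\<^const>\<open>ennreal\<close> truncates negative reals to \<open>0\<close>). It exists if the
  integrand is measurable on \<open>A\<close> and the difference is not \<open>\<infinity> - \<infinity>\<close>; only then is the value
  of \<open>ext_integral\<close> meaningful.
\<close>

definition ext_integral_exists :: "real set \<Rightarrow> (real \<Rightarrow> real) \<Rightarrow> bool" where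
  "ext_integral_exists A g \<longleftrightarrow>
     set_borel_measurable lborel A g \<and>
     ((\<integral>\<^sup>+x\<in>A. ennreal (g x) \<partial>lborel) < \<infinity> \<or> (\<integral>\<^sup>+x\<in>A. ennreal (- g x) \<partial>lborel) < \<infinity>)"

definition ext_integral :: "real set \<Rightarrow> (real \<Rightarrow> real) \<Rightarrow> ereal" where
  "ext_integral A g =
     enn2ereal (\<integral>\<^sup>+x\<in>A. ennreal (g x) \<partial>lborel) - enn2ereal (\<integral>\<^sup>+x\<in>A. ennreal (- g x) \<partial>lborel)"

text \<open>
  The convention \<open>0 ln 0 = 0\<close> holds automatically for the total function \<^const>\<open>ln\<close>. The
  argument of the logarithm is also \<open>0\<close> at \<open>x = 0\<close>, which has measure zero.
\<close>

definition genial_integrand :: "(real \<Rightarrow> real) \<Rightarrow> real \<Rightarrow> real" where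
  "genial_integrand f x = f x * ln (x * f x)"

definition genial_entropy :: "real set \<Rightarrow> (real \<Rightarrow> real) \<Rightarrow> ereal" where
  "genial_entropy I f = - 1 - ext_integral I (genial_integrand f)"

end

theory Submission
  imports Defs "HOL-Probability.Probability"
begin

text \<open>
  Let \<open>F x\<close> be the mass that \<open>f\<close> puts on \<open>[0, x]\<close>. Since \<open>f\<close> is decreasing and \<open>I\<close> reaches down
  to \<open>0\<close>, the rectangle of height \<open>f x\<close> over \<open>(0, x)\<close> lies under the graph of \<open>f\<close>, so
  \<open>x f(x) \<le> F x \<le> 1\<close> (\<open>corner_rectangle_le\<close>). Hence the integrand \<open>f ln (x f)\<close> is nowhere
  positive on \<open>I\<close>, which makes its extended integral exist, and \<open>- f ln (x f) \<ge> - f ln F\<close>.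
  Under the probability measure with density \<open>f\<close> the variable \<open>F\<close> is uniformly distributed on
  \<open>[0, 1]\<close>, so the integral of \<open>- f ln F\<close> equals that of \<open>- ln\<close> over \<open>[0, 1]\<close>, which is \<open>1\<close>.

  The last step is carried out without differentiating \<open>F\<close>: by the layer-cake formula it suffices
  to bound from below the probability of the event \<open>- ln (x f(x)) \<ge> t\<close>. Up to a null set,
  that event contains \<open>F \<le> exp (- t)\<close>, and the latter has probability at least \<open>exp (- t)\<close>
  because \<open>F\<close> is continuous (\<open>neg_ln_below_cdf_ge_1\<close>).
\<close>

section \<open>Random variables below their distribution function\<close>

lemma (in sigma_finite_measure) nn_integral_layer_cake:
  fixes X :: "'a \<Rightarrow> real"
  assumes [measurable]: "X \<in> borel_measurable M"
  shows "(\<integral>\<^sup>+x. ennreal (X x) \<partial>M) =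
    (\<integral>\<^sup>+t. emeasure M {x \<in> space M. t \<le> X x} * indicator {0..} t \<partial>lborel)"
proof -
  interpret pair_sigma_finite M lborel ..
  have "ennreal (X x) = (\<integral>\<^sup>+t. indicator {t. 0 \<le> t \<and> t \<le> X x} t \<partial>lborel)" for x
  proof -
    have "{t. 0 \<le> t \<and> t \<le> X x} = {0..X x}"
      by auto
    then show ?thesis
      by (simp add: emeasure_lborel_Icc_eq ennreal_neg)
  qed
  then have "(\<integral>\<^sup>+x. ennreal (X x) \<partial>M) =
      (\<integral>\<^sup>+x. \<integral>\<^sup>+t. indicator {t. 0 \<le> t \<and> t \<le> X x} t \<partial>lborel \<partial>M)"
    by simp
  also have "\<dots> = (\<integral>\<^sup>+t. \<integral>\<^sup>+x. indicator {t. 0 \<le> t \<and> t \<le> X x} t \<partial>M \<partial>lborel)"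
    by (rule Fubini'[symmetric]) measurable
  also have "\<dots> = (\<integral>\<^sup>+t. emeasure M {x \<in> space M. t \<le> X x} * indicator {0..} t \<partial>lborel)"
  proof (rule nn_integral_cong)
    fix t :: real
    have "(\<integral>\<^sup>+x. indicator {t. 0 \<le> t \<and> t \<le> X x} t \<partial>M) =
        (\<integral>\<^sup>+x. indicator {x \<in> space M. t \<le> X x} x * indicator {0..} t \<partial>M)"
      by (rule nn_integral_cong) (auto split: split_indicator)
    also have "\<dots> = emeasure M {x \<in> space M. t \<le> X x} * indicator {0..} t"
      by (subst nn_integral_multc) auto
    finally show "(\<integral>\<^sup>+x. indicator {t. 0 \<le> t \<and> t \<le> X x} t \<partial>M) =
        emeasure M {x \<in> space M. t \<le> X x} * indicator {0..} t" .
  qed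
  finally show ?thesis .
qed

text \<open>
  By continuity, \<open>{cdf M \<le> s}\<close> contains a half-line \<open>{..y}\<close> with \<open>cdf M y = s\<close>.
\<close>

lemma (in real_distribution) prob_cdf_le_ge:
  assumes atomless: "\<And>x. measure M {x} = 0" and s: "0 < s" "s \<le> 1"
  shows "s \<le> prob {x. cdf M x \<le> s}"
proof (cases "s = 1")
  case True
  then show ?thesis
    using prob_space by (simp add: cdf_bounded_prob)
next
  case False
  have "eventually (\<lambda>a. cdf M a < s) at_bot"
    using order_tendstoD(2)[OF cdf_lim_at_bot s(1)] .
  then obtain a where a: "cdf M a < s"
    by (metis eventually_at_bot_linorder order_refl)
  have "eventually (\<lambda>b. s < cdf M b) at_top"
    using False s order_tendstoD(1)[OF cdf_lim_at_top_prob] by simp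
  then obtain b where b: "s < cdf M b"
    by (metis eventually_at_top_linorder order_refl)
  have "a \<le> b"
    using a b cdf_nondecreasing[of b a] by linarith
  then obtain y where y: "cdf M y = s"
    using IVT[of "cdf M" a s b] a b atomless by (auto simp: isCont_cdf)
  have [measurable]: "cdf M \<in> borel_measurable borel"
    by (intro borel_measurable_mono monoI cdf_nondecreasing)
  have "prob {..y} \<le> prob {x. cdf M x \<le> s}"
    using cdf_nondecreasing[of _ y] by (intro finite_measure_mono) (auto simp: y)
  then show ?thesis
    using y by (simp add: cdf_def)
qed

text \<open>
  In the extreme case \<open>Y = cdf M\<close>, the variable \<open>- ln Y\<close> is exponentially distributed with
  mean \<open>1\<close>; a smaller \<open>Y\<close> only increases the integral. Positivity matters because
  \<open>ln 0 = 0\<close>.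
\<close>

lemma (in real_distribution) neg_ln_below_cdf_ge_1:
  assumes atomless: "\<And>x. measure M {x} = 0"
    and [measurable]: "Y \<in> borel_measurable borel"
    and below: "AE x in M. 0 < Y x \<and> Y x \<le> cdf M x"
  shows "1 \<le> (\<integral>\<^sup>+x. ennreal (- ln (Y x)) \<partial>M)"
proof -
  have [measurable]: "cdf M \<in> borel_measurable borel"
    by (intro borel_measurable_mono monoI cdf_nondecreasing)
  have tail: "ennreal (exp (- t)) \<le> emeasure M {x \<in> space M. t \<le> - ln (Y x)}" if "0 \<le> t" for t
  proof -
    have "exp (- t) \<le> prob {x. cdf M x \<le> exp (- t)}"
      using that by (intro prob_cdf_le_ge atomless) auto
    also have "\<dots> \<le> prob {x. t \<le> - ln (Y x)}"
    proof (rule finite_measure_mono_AE)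
      show "AE x in M. x \<in> {x. cdf M x \<le> exp (- t)} \<longrightarrow> x \<in> {x. t \<le> - ln (Y x)}"
        using below
      proof eventually_elim
        case (elim x)
        show ?case
        proof (clarsimp)
          assume "cdf M x \<le> exp (- t)"
          then have "Y x \<le> exp (- t)"
            using elim by linarith
          then show "t \<le> - ln (Y x)"
            using elim ln_mono[of "Y x" "exp (- t)"] by simp
        qed
      qed
    qed measurable
    finally show ?thesis
      by (simp add: emeasure_eq_measure)
  qed
  have "1 = (\<integral>\<^sup>+t. ennreal (exp (- t)) * indicator {0..} t \<partial>lborel)"
    using nn_intergal_power_times_exp_Ici[of 0] by simp
  also have "\<dots> \<le> (\<integral>\<^sup>+t. emeasure M {x \<in> space M. t \<le> - ln (Y x)} * indicator {0..} t \<partial>lborel)"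
    using tail by (intro nn_integral_mono) (auto split: split_indicator)
  also have "\<dots> = (\<integral>\<^sup>+x. ennreal (- ln (Y x)) \<partial>M)"
    by (rule nn_integral_layer_cake[symmetric]) simp
  finally show ?thesis .
qed

section \<open>Corner densities\<close>

text \<open>
  The Bochner integral of a non-integrable function is \<open>0\<close>, so total mass \<open>1\<close> forces integrability.
\<close>

lemma corner_density_integrable:
  assumes "corner_density I f"
  shows "integrable lborel (\<lambda>x. indicator I x * f x)"
  using assms not_integrable_integral_eq[of lborel "\<lambda>x. indicator I x * f x"]
  unfolding corner_density_def set_lebesgue_integral_def by auto

lemma corner_density_nn_integral:
  assumes "corner_density I f"
  shows "(\<integral>\<^sup>+x. ennreal (indicator I x * f x) \<partial>lborel) = 1"
proof -
  have "(\<integral>\<^sup>+x. ennreal (indicator I x * f x) \<partial>lborel) =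
      ennreal (\<integral>x. indicator I x * f x \<partial>lborel)"
    using assms corner_density_integrable[OF assms]
    by (intro nn_integral_eq_integral) (auto simp: corner_density_def split: split_indicator)
  also have "\<dots> = 1"
    using assms by (simp add: corner_density_def set_lebesgue_integral_def)
  finally show ?thesis .
qed

text \<open>
  The left-hand side is the area of the rectangle \<open>(0, x) \<times> (0, f x)\<close>. It lies under
  the graph because \<open>I\<close> contains \<open>(0, x]\<close> and \<open>f\<close> is at least \<open>f x\<close> there.
\<close>

lemma corner_rectangle_le:
  assumes cd: "corner_density I f" and x: "x \<in> I"
  shows "ennreal (x * f x) \<le> (\<integral>\<^sup>+y\<in>{..x}. ennreal (indicator I y * f y) \<partial>lborel)"
proof -
  have x0: "0 \<le> x"
    using cd x by (auto simp: corner_density_def)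
  have below: "y \<in> I \<and> f x \<le> f y" if "0 < y" "y \<le> x" for y
  proof -
    have "is_interval (I \<union> {0})"
      using cd by (simp add: corner_density_def)
    then have "y \<in> I \<union> {0}"
      using that x by (meson UnCI insertI1 is_interval_1 less_imp_le)
    then have "y \<in> I"
      using that by auto
    then show ?thesis
      using cd x that by (auto simp: corner_density_def monotone_on_def)
  qed
  have "ennreal (x * f x) = (\<integral>\<^sup>+y. ennreal (f x) * indicator {0<..x} y \<partial>lborel)"
    using x0 cd x by (simp add: nn_integral_cmult ennreal_mult' mult.commute corner_density_def)
  also have "\<dots> \<le> (\<integral>\<^sup>+y\<in>{..x}. ennreal (indicator I y * f y) \<partial>lborel)"
    using below by (intro nn_integral_mono) (auto split: split_indicator intro: ennreal_leI)
  finally show ?thesis .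
qed

lemma corner_rectangle_le_1:
  assumes cd: "corner_density I f" and x: "x \<in> I"
  shows "x * f x \<le> 1"
proof -
  have "ennreal (x * f x) \<le> (\<integral>\<^sup>+y\<in>{..x}. ennreal (indicator I y * f y) \<partial>lborel)"
    by (rule corner_rectangle_le[OF assms])
  also have "\<dots> \<le> (\<integral>\<^sup>+y. ennreal (indicator I y * f y) \<partial>lborel)"
    by (intro nn_integral_mono) (auto split: split_indicator)
  finally show ?thesis
    by (simp add: corner_density_nn_integral[OF cd])
qed

lemma genial_integrand_nonpos:
  assumes cd: "corner_density I f" and x: "x \<in> I"
  shows "genial_integrand f x \<le> 0"
proof -
  have "0 \<le> x * f x" "0 \<le> f x"
    using cd x by (auto simp: corner_density_def)
  moreover have "ln (x * f x) \<le> 0"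
  proof (cases "x * f x = 0")
    case False
    then have "0 < x * f x"
      using \<open>0 \<le> x * f x\<close> by linarith
    then show ?thesis
      using corner_rectangle_le_1[OF assms] ln_mono[of "x * f x" 1] by simp
  qed auto
  ultimately show ?thesis
    by (simp add: genial_integrand_def mult_nonneg_nonpos)
qed

text \<open>
  On \<open>I\<close> the integrand is \<open>f x\<close> times \<open>- ln (x * f x)\<close>, so its integral is the expectation of
  the second factor under the distribution with density \<open>f\<close>.
\<close>

lemma genial_integral_ge_1:
  assumes cd: "corner_density I f"
  shows "1 \<le> (\<integral>\<^sup>+x\<in>I. ennreal (- genial_integrand f x) \<partial>lborel)"
proof -
  define u where "u x = indicator I x * f x" for x
  have [measurable]: "u \<in> borel_measurable borel"
    using corner_density_integrable[OF cd] unfolding u_def[abs_def] by auto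
  define M where "M = density lborel (\<lambda>x. ennreal (u x))"
  have emeasure_M: "emeasure M A = (\<integral>\<^sup>+y\<in>A. ennreal (u y) \<partial>lborel)" if "A \<in> sets borel" for A
    using that by (simp add: M_def emeasure_density)
  have sets_M: "sets M = sets borel"
    by (simp add: M_def)
  have "emeasure M (space M) = 1"
    using corner_density_nn_integral[OF cd] by (simp add: emeasure_M sets_eq_imp_space_eq[OF sets_M] u_def)
  then interpret M: prob_space M
    by (rule prob_spaceI)
  interpret M: real_distribution M
    by unfold_locales (rule sets_M)
  have atomless: "measure M {x} = 0" for x
  proof -
    have "AE y in lborel. y \<noteq> x"
      by (rule AE_lborel_singleton)
    then have "AE y in lborel. ennreal (u y) * indicator {x} y = 0"
      by eventually_elim simp
    then have "emeasure M {x} = 0"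
      by (subst emeasure_M) (auto simp: nn_integral_0_iff_AE)
    then show ?thesis
      by (simp add: measure_def)
  qed
  have below: "0 < x * u x \<and> x * u x \<le> cdf M x" if "0 < u x" "x \<noteq> 0" for x
  proof -
    have x: "x \<in> I" "u x = f x"
      using that by (auto simp: u_def split: split_indicator_asm)
    then have "0 < x"
      using cd that by (force simp: corner_density_def)
    moreover have "ennreal (x * u x) \<le> emeasure M {..x}"
      using corner_rectangle_le[OF cd x(1)] x by (simp add: emeasure_M) (simp add: u_def)
    ultimately show ?thesis
      using that by (simp add: M.emeasure_eq_measure cdf_def)
  qed
  \<comment> \<open>The zeros of \<open>u\<close> carry no mass under \<open>M\<close>, so the strict inequality holds almost surely.\<close>
  have "AE x in M. 0 < x * u x \<and> x * u x \<le> cdf M x"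
    unfolding M_def
  proof (subst AE_density)
    show "AE x in lborel. 0 < ennreal (u x) \<longrightarrow> 0 < x * u x \<and>
        x * u x \<le> cdf (density lborel (\<lambda>x. ennreal (u x))) x"
      using AE_lborel_singleton[of 0]
      by eventually_elim (use below in \<open>simp add: M_def\<close>)
  qed simp
  then have "1 \<le> (\<integral>\<^sup>+x. ennreal (- ln (x * u x)) \<partial>M)"
    using atomless by (intro M.neg_ln_below_cdf_ge_1) auto
  also have "\<dots> = (\<integral>\<^sup>+x. ennreal (u x) * ennreal (- ln (x * u x)) \<partial>lborel)"
    unfolding M_def by (intro nn_integral_density) auto
  also have "\<dots> = (\<integral>\<^sup>+x\<in>I. ennreal (- genial_integrand f x) \<partial>lborel)"
    using cd
    by (intro nn_integral_cong)
      (auto simp: u_def genial_integrand_def corner_density_def ennreal_mult'[symmetric]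
        split: split_indicator)
  finally show ?thesis .
qed

theorem theorem3:
  fixes I :: "real set" and f :: "real \<Rightarrow> real"
  assumes "corner_density I f"
  shows "ext_integral_exists I (genial_integrand f) \<and> genial_entropy I f \<ge> 0"
proof
  let ?u = "\<lambda>x. indicator I x * f x" and ?g = "genial_integrand f"
  let ?neg = "\<integral>\<^sup>+x\<in>I. ennreal (- ?g x) \<partial>lborel"
  have [measurable]: "?u \<in> borel_measurable borel"
    using corner_density_integrable[OF assms] by auto
  \<comment> \<open>Integrability makes the product \<open>?u\<close> measurable, so the integrand is expressed through it.\<close>
  have "(\<lambda>x. indicator I x *\<^sub>R ?g x) = (\<lambda>x. ?u x * ln (x * ?u x))"
    by (auto simp: genial_integrand_def fun_eq_iff split: split_indicator)
  then have meas: "set_borel_measurable lborel I ?g"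
    unfolding set_borel_measurable_def by simp
  have "ennreal (?g x) * indicator I x = 0" for x
    using genial_integrand_nonpos[OF assms, of x] by (auto simp: ennreal_neg split: split_indicator)
  then have pos: "(\<integral>\<^sup>+x\<in>I. ennreal (?g x) \<partial>lborel) = 0"
    by (simp only: nn_integral_const) simp
  show "ext_integral_exists I ?g"
    using meas pos by (simp add: ext_integral_exists_def)
  have "1 \<le> enn2ereal ?neg"
    using genial_integral_ge_1[OF assms] by (simp add: less_eq_ennreal.rep_eq one_ennreal.rep_eq)
  then show "0 \<le> genial_entropy I f"
    unfolding genial_entropy_def ext_integral_def pos
    by (cases "enn2ereal ?neg") (auto simp: zero_ennreal.rep_eq one_ereal_def)
qed

end
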